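(* Let $\mathcal{G}$ be the set of all growth rates $\mu:\mathbb{Z}\to\mathbb{R}^+$, and let $\mathcal{C}\subset\mathcal{G}/\!\approx$ be a chain that is totally ordered by $\lll$. For every system $x(k+1)=A(k)x(k)$, $k\in\mathbb{Z}$, with $A:\mathbb{Z}\to GL_d(\mathbb{R})$, there is at most one element of $\mathcal{C}$ (i.e. at most one $\approx$-class belonging to $\mathcal{C}$) having a representative $\mu$ for which the system admits both $\mu$-bounded growth and a $\mu$-dichotomy.
   Context: System: $A:\mathbb{Z}\to GL_d(\mathbb{R})$ ($d\geq 1$), and $x(k+1)=A(k)x(k)$, $k\in\mathbb{Z}$. Its evolution operator is $\Phi(k,n)=A(k-1)\cdots A(n)$ for $k>n$, $\Phi(n,n)=\mathrm{Id}$, $\Phi(k,n)=A^{-1}(k)\cdots A^{-1}(n-1)$ for $k<n$. Growth rate: a non-decreasing map $\mu:\mathbb{Z}\to\mathbb{R}^+=(0,\infty)$ with $\mu(0)=1$, $\lim_{n\to+\infty}\mu(n)=+\infty$, $\lim_{n\to-\infty}\mu(n)=0$. For growth rates $\mu,\omega$ and exponents $\alpha,\tilde\alpha<0$, $M\ge1$ consider the inequality $$(\ast)\qquad \left(\frac{\mu(k)}{\mu(n)}\right)^{\alpha}\le M\left(\frac{\omega(k)}{\omega(n)}\right)^{\tilde\alpha}\quad\text{for all }k\ge n.$$ $\mu$ is almost faster than $\omega$ if for every $\tilde\alpha<0$ there exist $M\ge1$ and $\alpha<0$ such that $(\ast)$ holds. $\omega$ is almost slower than $\mu$ if for every $\alpha<0$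 there exist $M\ge1$ and $\tilde\alpha<0$ such that $(\ast)$ holds. Equivalence: $\omega\approx\mu$ if each of $\omega,\mu$ is almost slower than the other and each is almost faster than the other. This is an equivalence relation on $\mathcal{G}$. Order on $\mathcal{G}/\!\approx$: $\mu_1\lll\mu_2$ if and only if $\mu_1$ is almost slower than $\mu_2$ and $\mu_2$ is almost faster than $\mu_1$ (defined via representatives). $\mu$-bounded growth: there are constants $\hat K\ge1$, $a\ge0$ with $\|\Phi(k,n)\|\le\hat K\left(\frac{\mu(k)}{\mu(n)}\right)^{\mathrm{sgn}(k-n)a}$ for all $k,n\in\mathbb{Z}$, where $\mathrm{sgn}(j)=1,0,-1$ for $j>0$, $j=0$, $j<0$ respectively. Invariant projector: a map $n\mapsto \mathrm{P}(n)$ of idempotent $d\times d$ matrices with $A(k)\mathrm{P}(k)=\mathrm{P}(k+1)A(k)$ for all $k\in\mathbb{Z}$. $\mu$-dichotomy: there are an invariant projector $\mathrm{P}$ and constants $K\ge1$, $\alpha<0$, $\beta>0$ with $\|\Phi(k,n)\mathrm{P}(n)\|\le K\left(\frac{\mu(k)}{\mu(n)}\right)^{\alpha}$ for all $k\ge n$ and $\|\Phi(k,n)[\mathrm{Id}-\mathrm{P}(n)]\|\le K\left(\frac{\mu(k)}{\mu(n)}\right)^{\beta}$ for all $k\le n$. *)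

theory Defs
  imports "HOL-Analysis.Analysis"
begin

definition growth_rates :: "(int \<Rightarrow> real) set" where
  "growth_rates = {\<mu>. mono \<mu> \<and> (\<forall>n. 0 < \<mu> n) \<and> \<mu> 0 = 1 \<and>
     filterlim \<mu> at_top at_top \<and> (\<mu> \<longlongrightarrow> 0) at_bot}"

text \<open>The inequality relating the exponents \<open>\<alpha>\<close> of \<open>\<mu>\<close> and \<open>\<alpha>'\<close> of \<open>\<omega>\<close>.\<close>

definition rate_dominates ::
    "(int \<Rightarrow> real) \<Rightarrow> (int \<Rightarrow> real) \<Rightarrow> real \<Rightarrow> real \<Rightarrow> real \<Rightarrow> bool" where
  "rate_dominates \<mu> \<omega> M \<alpha> \<alpha>' \<longleftrightarrow>
     (\<forall>k n. k \<ge> n \<longrightarrow> (\<mu> k / \<mu> n) powr \<alpha> \<le> M * (\<omega> k / \<omega> n) powr \<alpha>')"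

definition almost_faster :: "(int \<Rightarrow> real) \<Rightarrow> (int \<Rightarrow> real) \<Rightarrow> bool" where
  "almost_faster \<mu> \<omega> \<longleftrightarrow> (\<forall>\<alpha>'<0. \<exists>M\<ge>1. \<exists>\<alpha><0. rate_dominates \<mu> \<omega> M \<alpha> \<alpha>')"

definition almost_slower :: "(int \<Rightarrow> real) \<Rightarrow> (int \<Rightarrow> real) \<Rightarrow> bool" where
  "almost_slower \<omega> \<mu> \<longleftrightarrow> (\<forall>\<alpha><0. \<exists>M\<ge>1. \<exists>\<alpha>'<0. rate_dominates \<mu> \<omega> M \<alpha> \<alpha>')"

definition rate_equiv :: "((int \<Rightarrow> real) \<times> (int \<Rightarrow> real)) set" where
  "rate_equiv = {(\<omega>, \<mu>). \<omega> \<in> growth_rates \<and> \<mu> \<in> growth_rates \<and>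
     almost_slower \<omega> \<mu> \<and> almost_slower \<mu> \<omega> \<and>
     almost_faster \<omega> \<mu> \<and> almost_faster \<mu> \<omega>}"

text \<open>The order on classes is given by some pair of representatives; the choice is
  immaterial, see \<open>rate_order_iff\<close>.\<close>

definition rate_order :: "((int \<Rightarrow> real) set \<times> (int \<Rightarrow> real) set) set" where
  "rate_order = {(X, Y). X \<in> growth_rates // rate_equiv \<and> Y \<in> growth_rates // rate_equiv \<and>
     (\<exists>\<mu>\<^sub>1\<in>X. \<exists>\<mu>\<^sub>2\<in>Y. almost_slower \<mu>\<^sub>1 \<mu>\<^sub>2 \<and> almost_faster \<mu>\<^sub>2 \<mu>\<^sub>1)}"

lemma rate_dominates_refl: "rate_dominates \<mu> \<mu> 1 \<alpha> \<alpha>"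
  by (simp add: rate_dominates_def)

lemma rate_dominates_trans:
  assumes "rate_dominates \<mu> \<omega> M \<alpha> \<beta>" "rate_dominates \<omega> \<nu> N \<beta> \<gamma>" "M \<ge> 1"
  shows "rate_dominates \<mu> \<nu> (M * N) \<alpha> \<gamma>"
  unfolding rate_dominates_def
proof (intro allI impI)
  fix k n :: int assume "k \<ge> n"
  then have "(\<mu> k / \<mu> n) powr \<alpha> \<le> M * (\<omega> k / \<omega> n) powr \<beta>"
    using assms(1) by (simp add: rate_dominates_def)
  also have "\<dots> \<le> M * (N * (\<nu> k / \<nu> n) powr \<gamma>)"
    using assms(2,3) \<open>k \<ge> n\<close> by (intro mult_left_mono) (auto simp: rate_dominates_def)
  finally show "(\<mu> k / \<mu> n) powr \<alpha> \<le> M * N * (\<nu> k / \<nu> n) powr \<gamma>"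
    by (simp add: mult.assoc)
qed

lemma mult_ge_one: "(M::real) \<ge> 1 \<Longrightarrow> N \<ge> 1 \<Longrightarrow> M * N \<ge> 1"
  using mult_mono[of 1 M 1 N] by simp

lemma almost_faster_refl: "almost_faster \<mu> \<mu>"
  unfolding almost_faster_def using rate_dominates_refl by (metis order_refl)

lemma almost_slower_refl: "almost_slower \<mu> \<mu>"
  unfolding almost_slower_def using rate_dominates_refl by (metis order_refl)

lemma almost_faster_trans:
  assumes "almost_faster \<mu> \<omega>" "almost_faster \<omega> \<nu>"
  shows "almost_faster \<mu> \<nu>"
  using assms unfolding almost_faster_def
  by (meson rate_dominates_trans mult_ge_one)

lemma almost_slower_trans:
  assumes "almost_slower \<nu> \<omega>" "almost_slower \<omega> \<mu>"
  shows "almost_slower \<nu> \<mu>"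
  using assms unfolding almost_slower_def
  by (meson rate_dominates_trans mult_ge_one)

lemma equiv_rate_equiv: "equiv growth_rates rate_equiv"
proof (rule equivI)
  show "rate_equiv \<subseteq> growth_rates \<times> growth_rates"
    by (auto simp: rate_equiv_def)
  show "refl_on growth_rates rate_equiv"
    by (auto simp: refl_on_def rate_equiv_def almost_faster_refl almost_slower_refl)
  show "sym rate_equiv"
    by (auto simp: sym_def rate_equiv_def)
  show "trans rate_equiv"
    unfolding trans_def rate_equiv_def
    by (auto intro: almost_faster_trans almost_slower_trans)
qed

lemma rate_order_iff:
  assumes "\<mu>\<^sub>1 \<in> growth_rates" "\<mu>\<^sub>2 \<in> growth_rates"
  shows "(rate_equiv `` {\<mu>\<^sub>1}, rate_equiv `` {\<mu>\<^sub>2}) \<in> rate_order \<longleftrightarrow>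
         almost_slower \<mu>\<^sub>1 \<mu>\<^sub>2 \<and> almost_faster \<mu>\<^sub>2 \<mu>\<^sub>1"
proof
  assume "(rate_equiv `` {\<mu>\<^sub>1}, rate_equiv `` {\<mu>\<^sub>2}) \<in> rate_order"
  then obtain \<nu>\<^sub>1 \<nu>\<^sub>2 where "(\<mu>\<^sub>1, \<nu>\<^sub>1) \<in> rate_equiv" "(\<mu>\<^sub>2, \<nu>\<^sub>2) \<in> rate_equiv"
    "almost_slower \<nu>\<^sub>1 \<nu>\<^sub>2" "almost_faster \<nu>\<^sub>2 \<nu>\<^sub>1"
    by (auto simp: rate_order_def)
  then show "almost_slower \<mu>\<^sub>1 \<mu>\<^sub>2 \<and> almost_faster \<mu>\<^sub>2 \<mu>\<^sub>1"
    by (auto simp: rate_equiv_def intro: almost_faster_trans almost_slower_trans)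
next
  assume "almost_slower \<mu>\<^sub>1 \<mu>\<^sub>2 \<and> almost_faster \<mu>\<^sub>2 \<mu>\<^sub>1"
  moreover have "\<mu>\<^sub>1 \<in> rate_equiv `` {\<mu>\<^sub>1}" "\<mu>\<^sub>2 \<in> rate_equiv `` {\<mu>\<^sub>2}"
    using assms equiv_class_self[OF equiv_rate_equiv] by auto
  ultimately show "(rate_equiv `` {\<mu>\<^sub>1}, rate_equiv `` {\<mu>\<^sub>2}) \<in> rate_order"
    using assms unfolding rate_order_def by (auto intro: quotientI)
qed

lemma partial_order_rate_order:
  "partial_order_on (growth_rates // rate_equiv) rate_order"
  unfolding partial_order_on_def preorder_on_def
proof (intro conjI)
  show "rate_order \<subseteq> (growth_rates // rate_equiv) \<times> (growth_rates // rate_equiv)"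
    by (auto simp: rate_order_def)
  show "refl_on (growth_rates // rate_equiv) rate_order"
    by (auto simp: refl_on_def rate_order_iff almost_faster_refl almost_slower_refl
        elim!: quotientE)
  show "trans rate_order"
  proof (rule transI)
    fix X Y Z assume *: "(X, Y) \<in> rate_order" "(Y, Z) \<in> rate_order"
    then have "X \<in> growth_rates // rate_equiv" "Y \<in> growth_rates // rate_equiv"
      "Z \<in> growth_rates // rate_equiv"
      by (auto simp: rate_order_def)
    with * show "(X, Z) \<in> rate_order"
      by (auto simp: rate_order_iff elim!: quotientE
          intro: almost_faster_trans almost_slower_trans)
  qed
  show "antisym rate_order"
  proof (rule antisymI)
    fix X Y assume *: "(X, Y) \<in> rate_order" "(Y, X) \<in> rate_order"
    then have "X \<in> growth_rates // rate_equiv" "Y \<in> growth_rates // rate_equiv"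
      by (auto simp: rate_order_def)
    then obtain \<mu> \<nu> where X: "X = rate_equiv `` {\<mu>}" "\<mu> \<in> growth_rates"
      and Y: "Y = rate_equiv `` {\<nu>}" "\<nu> \<in> growth_rates"
      by (auto elim!: quotientE)
    with * have "(\<mu>, \<nu>) \<in> rate_equiv"
      by (simp add: rate_order_iff) (simp add: rate_equiv_def)
    then show "X = Y"
      using X Y equiv_class_eq[OF equiv_rate_equiv] by simp
  qed
qed


text \<open>The type \<open>real^'d^'d\<close> has the Euclidean norm of all entries as its library norm;
  here \<open>\<parallel>\<cdot>\<parallel>\<close> is the operator norm induced by the Euclidean norm.\<close>

definition mat_norm :: "real^'d^'d \<Rightarrow> real" where
  "mat_norm B = onorm (\<lambda>x. B *v x)"

text \<open>\<open>evol_fwd A n j\<close> is \<open>A(n + j - 1) \<cdots> A(n)\<close> and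
  \<open>evol_bwd A n j\<close> is \<open>A(n - j)\<^sup>-\<^sup>1 \<cdots> A(n - 1)\<^sup>-\<^sup>1\<close>, each with \<open>j\<close> factors.\<close>

primrec evol_fwd :: "(int \<Rightarrow> real^'d^'d) \<Rightarrow> int \<Rightarrow> nat \<Rightarrow> real^'d^'d" where
  "evol_fwd A n 0 = mat 1"
| "evol_fwd A n (Suc j) = A (n + int j) ** evol_fwd A n j"

primrec evol_bwd :: "(int \<Rightarrow> real^'d^'d) \<Rightarrow> int \<Rightarrow> nat \<Rightarrow> real^'d^'d" where
  "evol_bwd A n 0 = mat 1"
| "evol_bwd A n (Suc j) = matrix_inv (A (n - int (Suc j))) ** evol_bwd A n j"

definition evol :: "(int \<Rightarrow> real^'d^'d) \<Rightarrow> int \<Rightarrow> int \<Rightarrow> real^'d^'d" where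
  "evol A k n = (if k \<ge> n then evol_fwd A n (nat (k - n)) else evol_bwd A n (nat (n - k)))"

definition bounded_growth :: "(int \<Rightarrow> real) \<Rightarrow> (int \<Rightarrow> real^'d^'d) \<Rightarrow> bool" where
  "bounded_growth \<mu> A \<longleftrightarrow>
     (\<exists>K\<ge>1. \<exists>a\<ge>0. \<forall>k n.
        mat_norm (evol A k n) \<le> K * (\<mu> k / \<mu> n) powr (of_int (sgn (k - n)) * a))"

definition invariant_projector :: "(int \<Rightarrow> real^'d^'d) \<Rightarrow> (int \<Rightarrow> real^'d^'d) \<Rightarrow> bool" where
  "invariant_projector A P \<longleftrightarrow>
     (\<forall>n. P n ** P n = P n) \<and> (\<forall>k. A k ** P k = P (k + 1) ** A k)"

definition dichotomy :: "(int \<Rightarrow> real) \<Rightarrow> (int \<Rightarrow> real^'d^'d) \<Rightarrow> bool" where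
  "dichotomy \<mu> A \<longleftrightarrow>
     (\<exists>P K \<alpha> \<beta>. invariant_projector A P \<and> K \<ge> 1 \<and> \<alpha> < 0 \<and> \<beta> > 0 \<and>
        (\<forall>k n. k \<ge> n \<longrightarrow> mat_norm (evol A k n ** P n) \<le> K * (\<mu> k / \<mu> n) powr \<alpha>) \<and>
        (\<forall>k n. k \<le> n \<longrightarrow>
           mat_norm (evol A k n ** (mat 1 - P n)) \<le> K * (\<mu> k / \<mu> n) powr \<beta>))"

end

theory Submission
  imports Defs
begin

text \<open>
  Two rates \<open>\<mu>\<close> and \<open>\<omega>\<close> for which the same system has both bounded growth and a dichotomy
  are always equivalent. The point is that a dichotomy forces the system to move
  at least as fast as some power of its rate, whereas bounded growth forbids it to move faster
  than some power of its rate. In detail, let \<open>k \<ge> n\<close>. If \<open>P n \<noteq> 0\<close>, a vector in the range of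
  \<open>P n\<close> has its norm multiplied by at most \<open>K (\<mu> k / \<mu> n)\<^sup>\<alpha>\<close> on its way from time
  \<open>n\<close> to time \<open>k\<close>, and by at most \<open>K' (\<omega> k / \<omega> n)\<^sup>a\<close> on its way back to time \<open>n\<close>; since it
  returns to itself, \<open>(\<mu> k / \<mu> n)\<^sup>-\<^sup>\<alpha> \<le> K K' (\<omega> k / \<omega> n)\<^sup>a\<close>. If the projector vanishes, the
  complementary projector is the identity and the same argument applies to the round trip
  \<open>k \<rightarrow> n \<rightarrow> k\<close>, which needs a nonzero vector and hence positive dimension. So a power of \<open>\<mu>\<close>
  is dominated by a power of \<open>\<omega>\<close> (lemma \<open>dichotomy_rate_le_growth_rate\<close>).

  Such a domination of powers makes \<open>\<mu>\<close> almost slower than \<open>\<omega>\<close> and \<open>\<omega>\<close> almost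
  faster than \<open>\<mu>\<close>, because exponents can be rescaled. Exchanging \<open>\<mu>\<close> and \<open>\<omega>\<close> gives equivalence.
\<close>

section \<open>The operator norm of matrices\<close>

lemma bounded_linear_matrix: "bounded_linear (\<lambda>x. (B :: real^'d^'d) *v x)"
  by (simp add: matrix_vector_mul_bounded_linear)

lemma mat_norm_mult_le: "mat_norm (B ** C) \<le> mat_norm B * mat_norm C"
  using onorm_compose[OF bounded_linear_matrix[of B] bounded_linear_matrix[of C]]
  by (simp add: mat_norm_def o_def matrix_vector_mul_assoc)

lemma mat_norm_nonneg: "0 \<le> mat_norm B"
  unfolding mat_norm_def by (rule onorm_pos_le[OF bounded_linear_matrix])

lemma mat_norm_idempotent_ge_1:
  fixes B :: "real^'d^'d"
  assumes "B ** B = B" "B \<noteq> 0"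
  shows "1 \<le> mat_norm B"
proof -
  obtain x where x: "B *v x \<noteq> 0"
    using assms(2) by (metis matrix_eq matrix_vector_mult_0)
  have "norm (B *v (B *v x)) \<le> mat_norm B * norm (B *v x)"
    unfolding mat_norm_def by (rule onorm[OF bounded_linear_matrix])
  then show ?thesis
    using x by (simp add: matrix_vector_mul_assoc assms(1))
qed

text \<open>Undoing \<open>C\<close> by \<open>D\<close> restores \<open>B\<close>, which has norm at least 1; so \<open>C\<close> cannot contract the
  range of \<open>B\<close> more than \<open>D\<close> can expand.\<close>

lemma round_trip_norm_ge_1:
  fixes B :: "real^'d^'d"
  assumes "B ** B = B" "B \<noteq> 0" "D ** C = mat 1"
  shows "1 \<le> mat_norm D * mat_norm (C ** B)"
proof -
  have "1 \<le> mat_norm (D ** (C ** B))"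
    using mat_norm_idempotent_ge_1[OF assms(1,2)] by (simp add: matrix_mul_assoc assms(3))
  also have "\<dots> \<le> mat_norm D * mat_norm (C ** B)"
    by (rule mat_norm_mult_le)
  finally show ?thesis .
qed

section \<open>Evolution operators and invariant projectors\<close>

lemma
  fixes B :: "real^'d^'d"
  assumes "invertible B"
  shows matrix_inv_left: "matrix_inv B ** B = mat 1"
    and matrix_inv_right: "B ** matrix_inv B = mat 1"
  using assms someI_ex[of "\<lambda>C. B ** C = mat 1 \<and> C ** B = mat 1"]
  unfolding invertible_def matrix_inv_def by auto

text \<open>The forward recursion adds factors on the left; to cancel against the backward product,
  the innermost factor has to be split off on the right.\<close>

lemma evol_fwd_Suc_right: "evol_fwd A n (Suc j) = evol_fwd A (n + 1) j ** A n"
  by (induction j) (simp_all add: matrix_mul_assoc add.assoc)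

lemma evol_bwd_fwd:
  fixes A :: "int \<Rightarrow> real^'d^'d"
  assumes "\<And>k. invertible (A k)"
  shows "evol_bwd A (n + int j) j ** evol_fwd A n j = mat 1"
proof (induction j arbitrary: n)
  case (Suc j)
  have "evol_bwd A (n + int (Suc j)) (Suc j) ** evol_fwd A n (Suc j) =
      matrix_inv (A n) ** (evol_bwd A ((n + 1) + int j) j ** evol_fwd A (n + 1) j) ** A n"
    by (simp add: evol_fwd_Suc_right matrix_mul_assoc add.assoc del: evol_fwd.simps)
  also have "\<dots> = mat 1"
    by (simp only: Suc.IH) (simp add: matrix_inv_left assms)
  finally show ?case .
qed simp

lemma evol_inverse:
  fixes A :: "int \<Rightarrow> real^'d^'d"
  assumes "\<And>k. invertible (A k)"
  shows "evol A n k ** evol A k n = mat 1"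
proof (cases "n \<le> k")
  case True
  then show ?thesis
    using evol_bwd_fwd[where A = A and n = n and j = "nat (k - n)", OF assms] by (auto simp: evol_def)
next
  case False
  then have "evol_bwd A n (nat (n - k)) ** evol_fwd A k (nat (n - k)) = mat 1"
    using evol_bwd_fwd[where A = A and n = k and j = "nat (n - k)", OF assms] by simp
  then have "evol_fwd A k (nat (n - k)) ** evol_bwd A n (nat (n - k)) = mat 1"
    by (rule matrix_left_right_inverse[THEN iffD1])
  then show ?thesis
    using False by (simp add: evol_def)
qed

lemma invariant_projector_eq_0:
  fixes A :: "int \<Rightarrow> real^'d^'d"
  assumes inv: "\<And>k. invertible (A k)" and P: "invariant_projector A P" and "P m = 0"
  shows "P k = 0"
proof (induction k rule: int_induct[where k = m])
  case (step1 i)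
  have "P (i + 1) ** A i = 0"
    using P step1 by (metis invariant_projector_def times0_right)
  then have "P (i + 1) ** (A i ** matrix_inv (A i)) = 0"
    by (simp add: matrix_mul_assoc)
  then show ?case
    by (simp add: matrix_inv_right inv)
next
  case (step2 i)
  have "A (i - 1) ** P (i - 1) = 0"
    using P step2 by (metis invariant_projector_def times0_left diff_add_cancel)
  then have "(matrix_inv (A (i - 1)) ** A (i - 1)) ** P (i - 1) = 0"
    by (simp flip: matrix_mul_assoc)
  then show ?case
    by (simp add: matrix_inv_left inv)
qed (rule assms(3))

section \<open>Comparison of the two rates\<close>

lemma growth_rate_ratio_ge_1:
  assumes "\<mu> \<in> growth_rates" "n \<le> k"
  shows "1 \<le> \<mu> k / \<mu> n"
  using assms by (simp add: growth_rates_def monoD)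

text \<open>The exponents \<open>sgn (k - n) * a\<close> make the bounds for the two time directions coincide.
  The bound is relaxed to a positive exponent, which can later be divided by.\<close>

lemma bounded_growth_symmetric:
  assumes "\<omega> \<in> growth_rates" "bounded_growth \<omega> A"
  obtains K a where "K \<ge> 1" "a > 0"
    "\<And>k n. n \<le> k \<Longrightarrow> mat_norm (evol A k n) \<le> K * (\<omega> k / \<omega> n) powr a"
    "\<And>k n. n \<le> k \<Longrightarrow> mat_norm (evol A n k) \<le> K * (\<omega> k / \<omega> n) powr a"
proof -
  obtain K a where K: "K \<ge> 1" and a: "a \<ge> 0" and
    bound: "\<And>k n. mat_norm (evol A k n) \<le> K * (\<omega> k / \<omega> n) powr (of_int (sgn (k - n)) * a)"
    using assms(2) unfolding bounded_growth_def by blast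
  have pos: "\<omega> i > 0" for i
    using assms(1) by (simp add: growth_rates_def)
  have relax: "K * (\<omega> k / \<omega> n) powr b \<le> K * (\<omega> k / \<omega> n) powr (a + 1)"
    if "n \<le> k" "b \<le> a + 1" for k n b
    using K growth_rate_ratio_ge_1[OF assms(1) that(1)] that(2)
    by (intro mult_left_mono powr_mono) auto
  show thesis
  proof (rule that[of K "a + 1"])
    fix k n :: int assume "n \<le> k"
    have "of_int (sgn (k - n)) * a \<le> a + 1"
      using a by (auto simp: sgn_if)
    then show "mat_norm (evol A k n) \<le> K * (\<omega> k / \<omega> n) powr (a + 1)"
      using bound[of k n] relax[OF \<open>n \<le> k\<close>] by (meson order_trans)
    have "(\<omega> n / \<omega> k) powr (of_int (sgn (n - k)) * a) =
        (\<omega> k / \<omega> n) powr (of_int (sgn (k - n)) * a)"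
      using pos[of n] pos[of k] by (auto simp: sgn_if powr_minus powr_divide field_simps)
    then show "mat_norm (evol A n k) \<le> K * (\<omega> k / \<omega> n) powr (a + 1)"
      using bound[of n k] relax[OF \<open>n \<le> k\<close> \<open>of_int (sgn (k - n)) * a \<le> a + 1\<close>] by simp
  qed (use K a in auto)
qed

text \<open>A round trip along a nontrivial stable or unstable direction costs one factor from the
  dichotomy and one from bounded growth, and their product is at least 1.\<close>

lemma dichotomy_rate_le_growth_rate:
  fixes A :: "int \<Rightarrow> real^'d^'d"
  assumes inv: "\<And>k. invertible (A k)"
    and \<mu>: "\<mu> \<in> growth_rates" and \<omega>: "\<omega> \<in> growth_rates"
    and dich: "dichotomy \<mu> A" and bg: "bounded_growth \<omega> A"
  obtains L \<gamma> a where "L \<ge> 1" "\<gamma> > 0" "a > 0"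
    "\<And>k n. n \<le> k \<Longrightarrow> (\<mu> k / \<mu> n) powr \<gamma> \<le> L * (\<omega> k / \<omega> n) powr a"
proof -
  obtain P K \<alpha> \<beta> where P: "invariant_projector A P" and K: "K \<ge> 1"
    and \<alpha>: "\<alpha> < 0" and \<beta>: "\<beta> > 0"
    and stable: "\<And>k n. k \<ge> n \<Longrightarrow> mat_norm (evol A k n ** P n) \<le> K * (\<mu> k / \<mu> n) powr \<alpha>"
    and unstable: "\<And>k n. k \<le> n \<Longrightarrow>
      mat_norm (evol A k n ** (mat 1 - P n)) \<le> K * (\<mu> k / \<mu> n) powr \<beta>"
    using dich unfolding dichotomy_def by blast
  obtain K' a where K': "K' \<ge> 1" and a: "a > 0"
    and fwd: "\<And>k n. n \<le> k \<Longrightarrow> mat_norm (evol A k n) \<le> K' * (\<omega> k / \<omega> n) powr a"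
    and bwd: "\<And>k n. n \<le> k \<Longrightarrow> mat_norm (evol A n k) \<le> K' * (\<omega> k / \<omega> n) powr a"
    using bounded_growth_symmetric[OF \<omega> bg] by blast
  have pos: "\<mu> i > 0" for i
    using \<mu> by (simp add: growth_rates_def)
  have cancel: "s powr \<gamma> \<le> K * K' * R"
    if trip: "1 \<le> x * y" "0 \<le> y" "x \<le> K' * R" "y \<le> K * s powr (- \<gamma>)"
      and R: "0 \<le> R" and s: "0 < s" for x y s \<gamma> R :: real
  proof -
    have "1 \<le> (K' * R) * (K * s powr (- \<gamma>))"
      using trip K' R mult_mono[of x "K' * R" y "K * s powr (- \<gamma>)"] by auto
    then show ?thesis
      using s by (simp add: powr_minus field_simps)
  qed
  show thesis
  proof (cases "\<exists>m. P m = 0")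
    case False
    show thesis
    proof (rule that[of "K * K'" "- \<alpha>" a])
      fix k n :: int assume "n \<le> k"
      show "(\<mu> k / \<mu> n) powr - \<alpha> \<le> K * K' * (\<omega> k / \<omega> n) powr a"
      proof (rule cancel)
        show "1 \<le> mat_norm (evol A n k) * mat_norm (evol A k n ** P n)"
          using P False
          by (intro round_trip_norm_ge_1 evol_inverse inv) (auto simp: invariant_projector_def)
      qed (use stable bwd \<open>n \<le> k\<close> pos in \<open>auto intro: mat_norm_nonneg\<close>)
    qed (use K K' \<alpha> a mult_ge_one in auto)
  next
    case True
    then have P0: "P i = 0" for i
      using invariant_projector_eq_0[OF inv P] by blast
    show thesis
    proof (rule that[of "K * K'" \<beta> a])
      fix k n :: int assume "n \<le> k"
      show "(\<mu> k / \<mu> n) powr \<beta> \<le> K * K' * (\<omega> k / \<omega> n) powr a"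
      proof (rule cancel)
        show "1 \<le> mat_norm (evol A k n) * mat_norm (evol A n k ** mat 1)"
          by (intro round_trip_norm_ge_1 evol_inverse inv) (simp_all, simp add: mat_def vec_eq_iff)
        have "(\<mu> n / \<mu> k) powr \<beta> = (\<mu> k / \<mu> n) powr (- \<beta>)"
          using pos[of n] pos[of k] by (simp add: powr_minus powr_divide)
        then show "mat_norm (evol A n k ** mat 1) \<le> K * (\<mu> k / \<mu> n) powr - \<beta>"
          using unstable[OF \<open>n \<le> k\<close>] by (simp add: P0)
      qed (use fwd \<open>n \<le> k\<close> pos in \<open>auto intro: mat_norm_nonneg\<close>)
    qed (use K K' \<beta> a mult_ge_one in auto)
  qed
qed

text \<open>Raising the inequality to a negative power \<open>\<delta>\<close> reverses it and rescales both exponents.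
  As \<open>\<delta>\<close> varies, either of \<open>a * \<delta>\<close> and \<open>\<gamma> * \<delta>\<close> takes every negative value, which
  serves both quantifier patterns at once.\<close>

lemma power_domination_imp_almost_slower_faster:
  assumes \<mu>: "\<mu> \<in> growth_rates" and \<omega>: "\<omega> \<in> growth_rates"
    and L: "L \<ge> 1" and \<gamma>: "\<gamma> > 0" and a: "a > 0"
    and le: "\<And>k n. n \<le> k \<Longrightarrow> (\<mu> k / \<mu> n) powr \<gamma> \<le> L * (\<omega> k / \<omega> n) powr a"
  shows "almost_slower \<mu> \<omega>" "almost_faster \<omega> \<mu>"
proof -
  have dom: "rate_dominates \<omega> \<mu> (L powr (- \<delta>)) (a * \<delta>) (\<gamma> * \<delta>)" if "\<delta> < 0" for \<delta>
    unfolding rate_dominates_def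
  proof (intro allI impI)
    fix k n :: int assume "n \<le> k"
    have s: "0 < \<mu> k / \<mu> n"
      using growth_rate_ratio_ge_1[OF \<mu> \<open>n \<le> k\<close>] by linarith
    have "(L * (\<omega> k / \<omega> n) powr a) powr \<delta> \<le> ((\<mu> k / \<mu> n) powr \<gamma>) powr \<delta>"
      using s le[OF \<open>n \<le> k\<close>] that by (intro powr_mono2') auto
    then have "L powr \<delta> * (\<omega> k / \<omega> n) powr (a * \<delta>) \<le> (\<mu> k / \<mu> n) powr (\<gamma> * \<delta>)"
      using L by (simp add: powr_mult powr_powr)
    then show "(\<omega> k / \<omega> n) powr (a * \<delta>) \<le> L powr (- \<delta>) * (\<mu> k / \<mu> n) powr (\<gamma> * \<delta>)"
      using L by (simp add: powr_minus field_simps)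
  qed
  have L_ge_1: "L powr (- \<delta>) \<ge> 1" if "\<delta> < 0" for \<delta>
    using L that by (simp add: ge_one_powr_ge_zero)
  show "almost_slower \<mu> \<omega>"
    unfolding almost_slower_def
  proof (intro allI impI)
    fix \<alpha> :: real assume "\<alpha> < 0"
    then have "\<alpha> / a < 0" "\<gamma> * (\<alpha> / a) < 0" "a * (\<alpha> / a) = \<alpha>"
      using a \<gamma> by (auto simp: divide_neg_pos mult_pos_neg)
    then show "\<exists>M\<ge>1. \<exists>\<alpha>'<0. rate_dominates \<omega> \<mu> M \<alpha> \<alpha>'"
      using dom L_ge_1 by metis
  qed
  show "almost_faster \<omega> \<mu>"
    unfolding almost_faster_def
  proof (intro allI impI)
    fix \<alpha>' :: real assume "\<alpha>' < 0"
    then have "\<alpha>' / \<gamma> < 0" "a * (\<alpha>' / \<gamma>) < 0" "\<gamma> * (\<alpha>' / \<gamma>) = \<alpha>'"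
      using a \<gamma> by (auto simp: divide_neg_pos mult_pos_neg)
    then show "\<exists>M\<ge>1. \<exists>\<alpha><0. rate_dominates \<omega> \<mu> M \<alpha> \<alpha>'"
      using dom L_ge_1 by metis
  qed
qed

lemma dichotomy_bounded_growth_imp_almost_slower_faster:
  fixes A :: "int \<Rightarrow> real^'d^'d"
  assumes "\<And>k. invertible (A k)" "\<mu> \<in> growth_rates" "\<omega> \<in> growth_rates"
    "dichotomy \<mu> A" "bounded_growth \<omega> A"
  shows "almost_slower \<mu> \<omega> \<and> almost_faster \<omega> \<mu>"
  using dichotomy_rate_le_growth_rate[OF assms]
    power_domination_imp_almost_slower_faster[OF assms(2,3)] by metis

section \<open>Uniqueness of the class of rates\<close>

theorem theorem5p7:
  fixes A :: "int \<Rightarrow> real^'d^'d"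
    and C :: "(int \<Rightarrow> real) set set"
  assumes "C \<subseteq> growth_rates // rate_equiv"
    and "C \<in> Chains rate_order"
    and "\<And>k. invertible (A k)"
  shows "\<exists>\<^sub>\<le>\<^sub>1X. X \<in> C \<and> (\<exists>\<mu>\<in>X. bounded_growth \<mu> A \<and> dichotomy \<mu> A)"
proof (rule Uniq_I, elim conjE bexE)
  fix X Y \<mu> \<omega>
  assume X: "X \<in> C" "\<mu> \<in> X" and Y: "Y \<in> C" "\<omega> \<in> Y"
    and A: "bounded_growth \<mu> A" "dichotomy \<mu> A" "bounded_growth \<omega> A" "dichotomy \<omega> A"
  have classes: "X \<in> growth_rates // rate_equiv" "Y \<in> growth_rates // rate_equiv"
    using assms(1) X(1) Y(1) by auto
  have rates: "\<mu> \<in> growth_rates" "\<omega> \<in> growth_rates"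
    using in_quotient_imp_subset[OF equiv_rate_equiv] classes X(2) Y(2) by auto
  have "(\<mu>, \<omega>) \<in> rate_equiv"
    using rates A dichotomy_bounded_growth_imp_almost_slower_faster[OF assms(3)]
    by (simp add: rate_equiv_def)
  then show "X = Y"
    using quotient_eqI[OF equiv_rate_equiv classes X(2) Y(2)] by simp
qed

end
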